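(* (i) For any function $f$, the set $\{s: s<_{\forall}f\}$ forms a ring (under pointwise addition and multiplication, not necessarily with identity) closed under taking positive powers; that is, for all $p>0$, $$g\in\{s:s<_{\forall}f\}\iff g^p\in\{s:s<_{\forall}f\}.$$ (ii) The set of subradical functions has neither a maximal element for the order $<_{\forall}$ nor one for the order $<_{\exists}$. (That is, for each of the two orders $<$ and every subradical $s$ there is a subradical $s'$ with $s<s'$.)
   Context: Functions are real-valued functions of a real variable $x$ defined for all sufficiently large $x$, and $o(\cdot)$ refers to $x\to\infty$: $f=o(h)$ means that for every $\delta>0$, $|f(x)|\le\delta|h(x)|$ for all sufficiently large $x$. Real powers are only taken of eventually non-negative functions; so in $f<_\forall g$, $f<_\exists g$ the function $g$ is eventually non-negative, and in (i) $f$ and the function $g$ whose powers are taken are eventually non-negative. $f<_{\forall}g$ ("$f$ is subradically dominated by $g$", written $<_{\sqrt[\forall]{\ }}$ in the paper) means: for every $\epsilon>0$, $f=o(g^\epsilon)$. $f<_{\exists}g$ ("$f$ is radically dominated by $g$", written $<_{\sqrt[\exists]{\ }}$ in the paper) means: there is $0<\epsilon<1$ with $f=o(g^{1-\epsilon})$. A function is subradical if it is subradically dominated by $x$, i.e. $f(x)=o(x^\epsilon)$ for every $\epsilon>0$. *)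

theory Defs
  imports Complex_Main "HOL-Library.Landau_Symbols" "HOL-Algebra.Ring"
begin

text \<open>
  Functions defined for all sufficiently large arguments are modelled as total functions
  on the reals. Every notion below is invariant under changing a function on a set that is
  bounded above, so the choice of values outside the original domain does not matter.
\<close>

abbreviation eventually_nonneg :: "(real \<Rightarrow> real) \<Rightarrow> bool" where
  "eventually_nonneg g \<equiv> eventually (\<lambda>x. 0 \<le> g x) at_top"

text \<open>
  Real powers are taken of eventually non-negative functions only, so this is part of both
  relations. Note that \<^term>\<open>(0::real) powr a\<close> is \<^term>\<open>0::real\<close>, the usual value for positive \<open>a\<close>.
\<close>

definition subradically_dominated :: "(real \<Rightarrow> real) \<Rightarrow> (real \<Rightarrow> real) \<Rightarrow> bool" where
  "subradically_dominated f g \<longleftrightarrow>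
     eventually_nonneg g \<and> (\<forall>\<epsilon>>0. f \<in> o[at_top](\<lambda>x. g x powr \<epsilon>))"

definition radically_dominated :: "(real \<Rightarrow> real) \<Rightarrow> (real \<Rightarrow> real) \<Rightarrow> bool" where
  "radically_dominated f g \<longleftrightarrow>
     eventually_nonneg g \<and> (\<exists>\<epsilon>. 0 < \<epsilon> \<and> \<epsilon> < 1 \<and> f \<in> o[at_top](\<lambda>x. g x powr (1 - \<epsilon>)))"

definition subradical :: "(real \<Rightarrow> real) \<Rightarrow> bool" where
  "subradical s \<longleftrightarrow> subradically_dominated s (\<lambda>x. x)"

text \<open>
  Rings not necessarily with identity: the axioms of the locale \<open>ring\<close> without those about
  \<open>\<one>\<close>. The field \<open>\<one>\<close> of the record is unconstrained and need not lie in the carrier.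
\<close>

locale rng = abelian_group R for R (structure) +
  assumes m_closed: "\<lbrakk>x \<in> carrier R; y \<in> carrier R\<rbrakk> \<Longrightarrow> x \<otimes> y \<in> carrier R"
    and m_assoc: "\<lbrakk>x \<in> carrier R; y \<in> carrier R; z \<in> carrier R\<rbrakk>
      \<Longrightarrow> (x \<otimes> y) \<otimes> z = x \<otimes> (y \<otimes> z)"
    and l_distr: "\<lbrakk>x \<in> carrier R; y \<in> carrier R; z \<in> carrier R\<rbrakk>
      \<Longrightarrow> (x \<oplus> y) \<otimes> z = x \<otimes> z \<oplus> y \<otimes> z"
    and r_distr: "\<lbrakk>x \<in> carrier R; y \<in> carrier R; z \<in> carrier R\<rbrakk>
      \<Longrightarrow> z \<otimes> (x \<oplus> y) = z \<otimes> x \<oplus> z \<otimes> y"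

definition pointwise_structure :: "(real \<Rightarrow> real) set \<Rightarrow> (real \<Rightarrow> real) ring" where
  "pointwise_structure A =
     \<lparr>carrier = A, mult = (\<lambda>g h x. g x * h x), one = (\<lambda>x. 1),
      zero = (\<lambda>x. 0), add = (\<lambda>g h x. g x + h x)\<rparr>"

end

theory Submission
  imports Defs
begin

text \<open>
  For each fixed \<open>\<epsilon>\<close> the functions \<open>o(f\<^sup>\<epsilon>)\<close> form an additive group. Products and powers stay in
  the intersection over all \<open>\<epsilon>\<close> because \<open>\<epsilon>\<close> is arbitrary: a product of two functions is \<open>o(f\<^sup>\<epsilon>)\<close>
  as soon as each factor is \<open>o(f\<^bsup>\<epsilon>/2\<^esup>)\<close>, and raising to the power \<open>p\<close> merely replaces \<open>\<epsilon>\<close> by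
  \<open>p\<epsilon>\<close>.

  For the absence of maximal elements, pass to logarithms. If \<open>w \<rightarrow> \<infinity>\<close> and \<open>v = o(w)\<close>, then
  \<open>exp v\<close> is subradically dominated by \<open>exp w\<close> (\<open>subradically_dominated_exp\<close>), and conversely
  \<open>s\<close> is subradical only if \<open>ln (1 + \<bar>s\<bar>) = o(ln x)\<close> (\<open>subradical_imp_ln_smallo\<close>). So it
  suffices to put a function strictly between \<open>v = 1 + ln (1 + \<bar>s\<bar>)\<close> and \<open>ln x\<close> for the relation
  \<open>o\<close>. The geometric mean \<open>m = sqrt (v ln x)\<close> is such a function, and \<open>s' = exp m\<close> is
  subradical and dominates \<open>s\<close> (\<open>subradical_interpolation\<close>). Radical domination of \<open>s\<close> by the
  same \<open>s'\<close> is the instance \<open>\<epsilon> = 1 - \<epsilon> = 1/2\<close>.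
\<close>

lemma subradically_dominated_add:
  assumes "subradically_dominated g f" "subradically_dominated h f"
  shows "subradically_dominated (\<lambda>x. g x + h x) f"
  using assms unfolding subradically_dominated_def by (auto intro: sum_in_smallo)

lemma subradically_dominated_uminus:
  assumes "subradically_dominated g f"
  shows "subradically_dominated (\<lambda>x. - g x) f"
  using assms unfolding subradically_dominated_def by simp

lemma subradically_dominated_mult:
  assumes "subradically_dominated g f" "subradically_dominated h f"
  shows "subradically_dominated (\<lambda>x. g x * h x) f"
  unfolding subradically_dominated_def
proof (intro conjI allI impI)
  show "eventually_nonneg f"
    using assms(1) by (simp add: subradically_dominated_def)
next
  fix \<epsilon> :: real assume "\<epsilon> > 0"
  hence "(\<lambda>x. g x * h x) \<in> o[at_top](\<lambda>x. f x powr (\<epsilon>/2) * f x powr (\<epsilon>/2))"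
    using assms by (intro landau_o.small_mult) (auto simp: subradically_dominated_def)
  thus "(\<lambda>x. g x * h x) \<in> o[at_top](\<lambda>x. f x powr \<epsilon>)"
    by (simp flip: powr_add)
qed

lemma subradically_dominated_powr:
  assumes "subradically_dominated g f" "eventually_nonneg g" "p > 0"
  shows "subradically_dominated (\<lambda>x. g x powr p) f"
  unfolding subradically_dominated_def
proof (intro conjI allI impI)
  show "eventually_nonneg f"
    using assms(1) by (simp add: subradically_dominated_def)
next
  fix \<epsilon> :: real assume "\<epsilon> > 0"
  hence "g \<in> o[at_top](\<lambda>x. f x powr (\<epsilon>/p))"
    using assms by (auto simp: subradically_dominated_def)
  hence "(\<lambda>x. g x powr p) \<in> o[at_top](\<lambda>x. (f x powr (\<epsilon>/p)) powr p)"
    using assms by (intro smallo_powr_nonneg) auto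
  thus "(\<lambda>x. g x powr p) \<in> o[at_top](\<lambda>x. f x powr \<epsilon>)"
    using assms(3) by (simp add: powr_powr)
qed

text \<open>The converse direction is the same statement for the power \<open>1/p\<close>, which recovers \<open>g\<close>.\<close>

lemma subradically_dominated_powr_iff:
  assumes "eventually_nonneg g" "p > 0"
  shows "subradically_dominated (\<lambda>x. g x powr p) f \<longleftrightarrow> subradically_dominated g f"
proof
  assume "subradically_dominated (\<lambda>x. g x powr p) f"
  hence "subradically_dominated (\<lambda>x. (g x powr p) powr (1/p)) f"
    by (rule subradically_dominated_powr) (use assms in auto)
  moreover have "eventually (\<lambda>x. (g x powr p) powr (1/p) = g x) at_top"
    using assms(1) by eventually_elim (use assms(2) in \<open>simp add: powr_powr\<close>)
  ultimately show "subradically_dominated g f"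
    by (simp add: subradically_dominated_def landau_o.small.in_cong)
qed (use assms in \<open>intro subradically_dominated_powr\<close>)

lemma rng_subradically_dominated:
  assumes "eventually_nonneg f"
  shows "rng (pointwise_structure {s. subradically_dominated s f})"
proof -
  let ?R = "pointwise_structure {s. subradically_dominated s f}"
  have "abelian_group ?R"
  proof (rule abelian_groupI)
    fix g assume g: "g \<in> carrier ?R"
    show "\<exists>h\<in>carrier ?R. h \<oplus>\<^bsub>?R\<^esub> g = \<zero>\<^bsub>?R\<^esub>"
      using g subradically_dominated_uminus[of g f]
      by (intro bexI[of _ "\<lambda>x. - g x"]) (auto simp: pointwise_structure_def)
  qed (use assms in \<open>auto simp: pointwise_structure_def subradically_dominated_add
         subradically_dominated_def algebra_simps intro: sum_in_smallo\<close>)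
  moreover have "rng_axioms ?R"
    by unfold_locales
       (auto simp: pointwise_structure_def subradically_dominated_mult algebra_simps)
  ultimately show ?thesis
    by (rule rng.intro)
qed

lemma subradically_dominated_exp:
  assumes vw: "v \<in> o[at_top](w)" and w: "filterlim w at_top at_top"
  shows "subradically_dominated (\<lambda>x. exp (v x)) (\<lambda>x. exp (w x))"
  unfolding subradically_dominated_def
proof (intro conjI allI impI)
  fix \<epsilon> :: real assume \<epsilon>: "\<epsilon> > 0"
  show "(\<lambda>x. exp (v x)) \<in> o[at_top](\<lambda>x. exp (w x) powr \<epsilon>)"
  proof (rule landau_o.smallI)
    fix c :: real assume c: "c > 0"
    have "eventually (\<lambda>x. norm (v x) \<le> \<epsilon>/2 * norm (w x)) at_top"
      using vw \<epsilon> by (intro landau_o.smallD) auto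
    (* Half of the exponent absorbs v, the other half makes the quotient tend to 0. *)
    moreover have "eventually (\<lambda>x. w x \<ge> max 0 (- 2 / \<epsilon> * ln c)) at_top"
      using w unfolding filterlim_at_top by blast
    ultimately show "eventually (\<lambda>x. norm (exp (v x)) \<le> c * norm (exp (w x) powr \<epsilon>)) at_top"
    proof eventually_elim
      case (elim x)
      have "- ln c \<le> \<epsilon>/2 * w x"
        using elim(2) \<epsilon> by (simp add: field_simps)
      hence "v x \<le> ln c + \<epsilon> * w x"
        using elim by (simp add: abs_if split: if_splits)
      hence "exp (v x) \<le> exp (ln c + \<epsilon> * w x)"
        by simp
      also have "\<dots> = c * exp (w x) powr \<epsilon>"
        using c by (simp add: exp_add powr_def)
      finally show ?case by simp
    qed
  qed
qed simp

lemma subradical_imp_ln_smallo: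
  assumes "subradical s"
  shows "(\<lambda>x. ln (1 + \<bar>s x\<bar>)) \<in> o[at_top](ln)"
proof (rule landau_o.smallI)
  fix c :: real assume c: "c > 0"
  have "s \<in> o[at_top](\<lambda>x. x powr c)"
    using assms c by (auto simp: subradical_def subradically_dominated_def)
  hence "eventually (\<lambda>x. norm (s x) \<le> 1/2 * norm (x powr c)) at_top"
    by (rule landau_o.smallD) simp
  moreover have "eventually (\<lambda>x::real. x \<ge> 2 powr (1/c)) at_top"
    by (rule eventually_ge_at_top)
  moreover have "eventually (\<lambda>x::real. x \<ge> 1) at_top"
    by (rule eventually_ge_at_top)
  ultimately show "eventually (\<lambda>x. norm (ln (1 + \<bar>s x\<bar>)) \<le> c * norm (ln x)) at_top"
  proof eventually_elim
    case (elim x)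
    have "2 = (2 powr (1/c)) powr c"
      using c by (simp add: powr_powr)
    also have "\<dots> \<le> x powr c"
      using elim c by (intro powr_mono2) auto
    finally have "1 + \<bar>s x\<bar> \<le> x powr c"
      using elim by simp
    hence "ln (1 + \<bar>s x\<bar>) \<le> ln (x powr c)"
      by (subst ln_le_cancel_iff) (use elim in auto)
    also have "\<dots> = c * ln x"
      using elim by (simp add: ln_powr)
    finally show ?case
      using elim by simp
  qed
qed

text \<open>
  For eventually non-negative functions, the geometric mean lies strictly between its factors on the scale
  of \<open>o\<close>: a bound \<open>v \<le> c\<^sup>2 w\<close> gives both \<open>v \<le> c sqrt (v w)\<close> and \<open>sqrt (v w) \<le> c w\<close>.
\<close>

lemma smallo_geometric_mean:
  fixes v w :: "real \<Rightarrow> real"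
  assumes vw: "v \<in> o[F](w)"
    and nonneg: "eventually (\<lambda>x. v x \<ge> 0) F" "eventually (\<lambda>x. w x \<ge> 0) F"
  shows "v \<in> o[F](\<lambda>x. sqrt (v x * w x))" "(\<lambda>x. sqrt (v x * w x)) \<in> o[F](w)"
proof -
  have "eventually (\<lambda>x. v x \<le> c * sqrt (v x * w x) \<and> sqrt (v x * w x) \<le> c * w x) F"
    if c: "c > 0" for c :: real
  proof -
    have "eventually (\<lambda>x. norm (v x) \<le> c\<^sup>2 * norm (w x)) F"
      using vw c by (intro landau_o.smallD) auto
    with nonneg show ?thesis
    proof eventually_elim
      case (elim x)
      have "(v x)\<^sup>2 \<le> c\<^sup>2 * (v x * w x)"
        using elim mult_left_mono[of "v x" "c\<^sup>2 * w x" "v x"]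
        by (simp add: power2_eq_square mult_ac)
      hence "sqrt ((v x)\<^sup>2) \<le> sqrt (c\<^sup>2 * (v x * w x))"
        by (rule real_sqrt_le_mono)
      moreover have "v x * w x \<le> (c * w x)\<^sup>2"
        using elim mult_right_mono[of "v x" "c\<^sup>2 * w x" "w x"]
        by (simp add: power2_eq_square mult_ac)
      hence "sqrt (v x * w x) \<le> c * w x"
        using elim c by (intro real_le_lsqrt) auto
      ultimately show ?case
        using elim c by (simp add: real_sqrt_mult)
    qed
  qed
  note bounds = this
  show "v \<in> o[F](\<lambda>x. sqrt (v x * w x))"
  proof (rule landau_o.smallI)
    fix c :: real assume "c > 0"
    from bounds[OF this] nonneg
    show "eventually (\<lambda>x. norm (v x) \<le> c * norm (sqrt (v x * w x))) F"
      by eventually_elim auto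
  qed
  show "(\<lambda>x. sqrt (v x * w x)) \<in> o[F](w)"
  proof (rule landau_o.smallI)
    fix c :: real assume "c > 0"
    from bounds[OF this] nonneg
    show "eventually (\<lambda>x. norm (sqrt (v x * w x)) \<le> c * norm (w x)) F"
      by eventually_elim auto
  qed
qed

lemma subradical_interpolation:
  assumes "subradical s"
  obtains s' where "subradical s'" "subradically_dominated s s'"
proof
  (* The summand 1 keeps v away from 0, so that m tends to infinity even when s is small. *)
  define v where "v = (\<lambda>x. 1 + ln (1 + \<bar>s x\<bar>))"
  define m where "m = (\<lambda>x. sqrt (v x * ln x))"
  have v_ge: "v x \<ge> 1" for x
    by (simp add: v_def)
  have ln_nonneg: "eventually (\<lambda>x::real. ln x \<ge> 0) at_top"
    using eventually_ge_at_top[of 1] by eventually_elim simp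
  have "(\<lambda>_. 1) \<in> o[at_top](ln :: real \<Rightarrow> real)"
    unfolding smallomega_iff_smallo[symmetric]
    by (intro smallomegaI_filterlim_at_infinity filterlim_at_top_imp_at_infinity)
       (simp add: ln_at_top)
  hence "v \<in> o[at_top](ln)"
    unfolding v_def using subradical_imp_ln_smallo[OF assms] by (intro sum_in_smallo)
  moreover have "eventually (\<lambda>x. v x \<ge> 0) at_top"
    using v_ge by (intro always_eventually allI) (meson order_trans zero_le_one)
  ultimately have vm: "v \<in> o[at_top](m)" and m_ln: "m \<in> o[at_top](ln)"
    unfolding m_def using smallo_geometric_mean[of v at_top ln] ln_nonneg by auto
  have "eventually (\<lambda>x. sqrt (ln x) \<le> m x) at_top"
    using ln_nonneg
    by eventually_elim (use v_ge mult_right_mono[of 1] in \<open>force simp: m_def\<close>)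
  hence m_top: "filterlim m at_top at_top"
    by (rule filterlim_at_top_mono[OF filterlim_compose[OF sqrt_at_top ln_at_top]])

  have exp_ln: "eventually (\<lambda>x::real. exp (ln x) = x) at_top"
    using eventually_gt_at_top[of 0] by eventually_elim simp
  have "subradically_dominated (\<lambda>x. exp (m x)) (\<lambda>x. exp (ln x))"
    using m_ln ln_at_top by (rule subradically_dominated_exp)
  moreover have "o[at_top](\<lambda>x::real. exp (ln x) powr \<epsilon>) = o[at_top](\<lambda>x. x powr \<epsilon>)" for \<epsilon>
    by (intro landau_o.small.cong) (use exp_ln in eventually_elim, simp)
  ultimately show "subradical (\<lambda>x. exp (m x))"
    unfolding subradical_def subradically_dominated_def
    using eventually_ge_at_top[of "0::real"] by auto

  have "\<bar>s x\<bar> \<le> exp (v x)" for x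
  proof -
    have "\<bar>s x\<bar> \<le> exp (ln (1 + \<bar>s x\<bar>))"
      by simp
    also have "\<dots> \<le> exp (v x)"
      unfolding exp_le_cancel_iff v_def by simp
    finally show ?thesis .
  qed
  hence "s \<in> O[at_top](\<lambda>x. exp (v x))"
    by (intro landau_o.big_mono always_eventually) auto
  thus "subradically_dominated s (\<lambda>x. exp (m x))"
    using subradically_dominated_exp[OF vm m_top] landau_o.big_small_trans
    unfolding subradically_dominated_def by blast
qed

lemma subradically_dominated_imp_radically_dominated:
  assumes "subradically_dominated f g"
  shows "radically_dominated f g"
  using assms unfolding subradically_dominated_def radically_dominated_def
  by (intro conjI exI[of _ "1/2"]) auto

theorem corollary6p2:
  "(\<forall>f :: real \<Rightarrow> real. eventually_nonneg f \<longrightarrow>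
      rng (pointwise_structure {s. subradically_dominated s f}) \<and>
      (\<forall>p::real. p > 0 \<longrightarrow> (\<forall>g :: real \<Rightarrow> real. eventually_nonneg g \<longrightarrow>
         (g \<in> {s. subradically_dominated s f} \<longleftrightarrow>
          (\<lambda>x. g x powr p) \<in> {s. subradically_dominated s f})))) \<and>
   (\<forall>s. subradical s \<longrightarrow> (\<exists>s'. subradical s' \<and> subradically_dominated s s')) \<and>
   (\<forall>s. subradical s \<longrightarrow> (\<exists>s'. subradical s' \<and> radically_dominated s s'))"
  using rng_subradically_dominated subradically_dominated_powr_iff
    subradical_interpolation subradically_dominated_imp_radically_dominated
  unfolding mem_Collect_eq by metis

end
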